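(* Consider the uniformly random $n\times n$ jigsaw puzzle with $q$ colors in the version where pieces have fixed orientation (they may not be rotated). Let $q=q(n)$ be any sequence of integers with $q(n)\ge 2$ for all $n$ and $q(n)\leq \frac{1}{\sqrt{e}}\,n-\omega(\log_2 n)$, i.e. $\left(\frac{1}{\sqrt e}n-q(n)\right)/\log_2 n\to\infty$ as $n\to\infty$. Then the probability that the puzzle has a unique vertex assembly or a unique edge assembly tends to $0$ as $n\to\infty$; that is, asymptotically almost surely it has neither.
   Context: Random puzzle: the $n\times n$ board is cut into $n^2$ unit square cells. The resulting grid has $2n(n+1)$ unit edges (including those on the boundary of the board), and each of them is colored independently and uniformly at random with one of $q$ colors. The cell at each position, together with the colors of its four sides, is a jigsaw piece; thus two pieces that share a side have the same color on that side. Assemblies with fixed orientation: the $n^2$ pieces are put unordered in a box, but the orientation of each piece is known and may not be changed. A solution (valid assembly) is a placement of the $n^2$ pieces bijectively on the cells of the $n\times n$ board, each in its original orientation, such that whenever two pieces are placed in adjacent cells, the colors of their sides along the common edge coincide (there is no restriction along the boundary of the board). Each solution induces an edge coloring of the $2n(n+1)$ edges of the board. The puzzle has a unique vertex assembly if there is only one solution (the original position of each piece is determined). The puzzle has a unique edge assembly if all solutions induce the same edge coloring of the board (so solutions may differ by reshuffling identical pieces). *)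

theory Defs
  imports "HOL-Probability.Probability" "HOL-Probability.Product_PMF"
    "HOL-Combinatorics.Permutations"
begin

text \<open>
  The cell \<open>(i, j)\<close> lies in row \<open>i\<close> (counted from the top) and column \<open>j\<close>, with \<open>i, j < n\<close>.
  \<open>HEdge i j\<close> is the horizontal unit edge above cell \<open>(i, j)\<close> (for \<open>i = n\<close>: the bottom boundary),
  \<open>VEdge i j\<close> is the vertical unit edge left of cell \<open>(i, j)\<close> (for \<open>j = n\<close>: the right boundary).
\<close>

type_synonym cell = "nat \<times> nat"

datatype edge = HEdge nat nat | VEdge nat nat

type_synonym coloring = "edge \<Rightarrow> nat"

definition cells :: "nat \<Rightarrow> cell set" where
  "cells n = {..<n} \<times> {..<n}"

definition board_edges :: "nat \<Rightarrow> edge set" where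
  "board_edges n =
     {HEdge i j | i j. i \<le> n \<and> j < n} \<union> {VEdge i j | i j. i < n \<and> j \<le> n}"

definition random_coloring :: "nat \<Rightarrow> nat \<Rightarrow> coloring pmf" where
  "random_coloring n q = Pi_pmf (board_edges n) undefined (\<lambda>_. pmf_of_set {..<q})"

datatype piece = Piece (north: nat) (east: nat) (south: nat) (west: nat)

fun piece_at :: "coloring \<Rightarrow> cell \<Rightarrow> piece" where
  "piece_at c (i, j) =
     Piece (c (HEdge i j)) (c (VEdge i (Suc j))) (c (HEdge (Suc i) j)) (c (VEdge i j))"

text \<open>
  The individual pieces are named by their original cells, so pieces that look alike are still
  different pieces.  In a placement \<open>\<sigma>\<close>, cell \<open>v\<close> receives the piece that was originally at
  \<open>\<sigma> v\<close>.  Using \<open>permutes\<close> fixes \<open>\<sigma>\<close> outside the board, so that different functions are different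
  placements.
\<close>

definition is_solution :: "nat \<Rightarrow> coloring \<Rightarrow> (cell \<Rightarrow> cell) \<Rightarrow> bool" where
  "is_solution n c \<sigma> \<longleftrightarrow>
     \<sigma> permutes cells n \<and>
     (\<forall>i j. i < n \<and> Suc j < n \<longrightarrow>
        east (piece_at c (\<sigma> (i, j))) = west (piece_at c (\<sigma> (i, Suc j)))) \<and>
     (\<forall>i j. Suc i < n \<and> j < n \<longrightarrow>
        south (piece_at c (\<sigma> (i, j))) = north (piece_at c (\<sigma> (Suc i, j))))"

text \<open>
  For an inner edge, the following reads the color off the piece below or to the right of it;
  in a solution the piece on the other side shows the same color (see
  \<open>induced_coloring_solution\<close>).
\<close>

fun induced_coloring :: "nat \<Rightarrow> coloring \<Rightarrow> (cell \<Rightarrow> cell) \<Rightarrow> coloring" where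
  "induced_coloring n c \<sigma> (HEdge i j) =
     (if i < n then north (piece_at c (\<sigma> (i, j))) else south (piece_at c (\<sigma> (i - 1, j))))"
| "induced_coloring n c \<sigma> (VEdge i j) =
     (if j < n then west (piece_at c (\<sigma> (i, j))) else east (piece_at c (\<sigma> (i, j - 1))))"

definition unique_vertex_assembly :: "nat \<Rightarrow> coloring \<Rightarrow> bool" where
  "unique_vertex_assembly n c \<longleftrightarrow> (\<exists>!\<sigma>. is_solution n c \<sigma>)"

definition unique_edge_assembly :: "nat \<Rightarrow> coloring \<Rightarrow> bool" where
  "unique_edge_assembly n c \<longleftrightarrow>
     (\<forall>\<sigma> \<tau>. is_solution n c \<sigma> \<longrightarrow> is_solution n c \<tau> \<longrightarrow>
        (\<forall>e \<in> board_edges n. induced_coloring n c \<sigma> e = induced_coloring n c \<tau> e))"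

lemma board_edges_altdef:
  "board_edges n =
     (\<lambda>(i, j). HEdge i j) ` ({..n} \<times> {..<n}) \<union> (\<lambda>(i, j). VEdge i j) ` ({..<n} \<times> {..n})"
  by (auto simp: board_edges_def)

lemma finite_board_edges: "finite (board_edges n)"
  by (simp add: board_edges_altdef)

lemma card_board_edges: "card (board_edges n) = 2 * n * (n + 1)"
  unfolding board_edges_altdef
  by (subst card_Un_disjoint) (auto simp: card_image inj_on_def)

lemma induced_coloring_solution:
  assumes "is_solution n c \<sigma>" "(i, j) \<in> cells n"
  shows "piece_at (induced_coloring n c \<sigma>) (i, j) = piece_at c (\<sigma> (i, j))"
proof -
  have "i < n" "j < n" using assms(2) by (auto simp: cells_def)
  moreover have "n = Suc i" if "\<not> Suc i < n" using that \<open>i < n\<close> by simp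
  moreover have "n = Suc j" if "\<not> Suc j < n" using that \<open>j < n\<close> by simp
  ultimately show ?thesis
    using assms(1) by (cases "Suc i < n"; cases "Suc j < n"; intro piece.expand)
      (simp_all add: is_solution_def)
qed

lemma is_solution_id: "is_solution n c id"
  by (auto simp: is_solution_def permutes_id)

lemma induced_coloring_id:
  assumes "e \<in> board_edges n"
  shows "induced_coloring n c id e = c e"
  using assms by (auto simp: board_edges_def)

end

(* A coloring whose edge assembly is unique can be reconstructed from the multiset of its pieces, so
   at most as many colorings have a unique edge assembly as there are multisets of n^2 elements
   over the q^4 piece types.  Against the q^(2n(n+1)) colorings, Stirling's lower bound for (n^2)!
   bounds the probability by (e(q^2/n^2 + 1/q^2))^(n^2) * q^(-2n).  The base is at most 1 throughout
   the range 2 <= q <= n/sqrt(e) - 1: for q <= n/3 both summands are small, and beyond that the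
   gap between q and n/sqrt(e) outweighs the summand 1/q^2.  A unique vertex assembly is in
   particular a unique edge assembly, since pieces are named by their cells. *)
theory Submission
  imports Defs
begin

lemma finite_cells: "finite (cells n)" and card_cells: "card (cells n) = n\<^sup>2"
  by (simp_all add: cells_def power2_eq_square)

lemma unique_vertex_imp_unique_edge:
  "unique_vertex_assembly n c \<Longrightarrow> unique_edge_assembly n c"
  unfolding unique_vertex_assembly_def unique_edge_assembly_def by blast

text \<open>Equal multisets give a permutation \<open>\<sigma>\<close> that fills each cell with a
  piece of \<open>c\<close> looking like the piece of \<open>d\<close> there. Neighbouring pieces of
  \<open>d\<close> share an edge, so \<open>\<sigma>\<close> solves the puzzle of \<open>c\<close>.
  It induces \<open>d\<close>, whereas the identity induces \<open>c\<close>.\<close>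

lemma unique_edge_assembly_determined_by_pieces:
  assumes uniq: "unique_edge_assembly n c"
    and mset: "image_mset (piece_at d) (mset_set (cells n)) =
               image_mset (piece_at c) (mset_set (cells n))"
    and e: "e \<in> board_edges n"
  shows "d e = c e"
proof -
  obtain \<sigma> where \<sigma>: "\<sigma> permutes cells n" "\<forall>v\<in>cells n. piece_at d v = piece_at c (\<sigma> v)"
    using image_mset_eq_implies_permutes[OF finite_cells mset] by blast
  have piece: "piece_at c (\<sigma> (i, j)) = piece_at d (i, j)" if "i < n" "j < n" for i j
    using \<sigma>(2) that by (simp add: cells_def)
  have "is_solution n c \<sigma>"
    using \<sigma>(1) by (simp add: is_solution_def piece)
  hence "induced_coloring n c \<sigma> e = induced_coloring n c id e"
    using uniq e is_solution_id unfolding unique_edge_assembly_def by blast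
  moreover have "induced_coloring n c \<sigma> e = d e"
    using e by (auto simp: board_edges_def piece)
  ultimately show ?thesis
    using induced_coloring_id[OF e] by simp
qed

definition pieces :: "nat \<Rightarrow> piece set" where
  "pieces q = (\<lambda>(a, b, c, d). Piece a b c d) ` ({..<q} \<times> {..<q} \<times> {..<q} \<times> {..<q})"

lemma finite_pieces: "finite (pieces q)"
  by (simp add: pieces_def)

lemma card_pieces: "card (pieces q) = q ^ 4"
  unfolding pieces_def by (subst card_image) (auto simp: inj_on_def power4_eq_xxxx)

lemma piece_at_in_pieces:
  assumes "\<And>e. e \<in> board_edges n \<Longrightarrow> c e < q" "v \<in> cells n"
  shows "piece_at c v \<in> pieces q"
  using assms by (cases v) (auto simp: pieces_def board_edges_def cells_def image_iff)

lemma card_unique_edge_assembly_le: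
  fixes n q :: nat
  defines "C \<equiv> PiE_dflt (board_edges n) undefined (\<lambda>_. {..<q})"
  shows "card (C \<inter> {c. unique_edge_assembly n c}) \<le> (q ^ 4 + n\<^sup>2 - 1) choose n\<^sup>2"
proof -
  let ?m = "\<lambda>c. image_mset (piece_at c) (mset_set (cells n))"
  have "inj_on ?m (C \<inter> {c. unique_edge_assembly n c})"
  proof (rule inj_onI)
    fix c d
    assume c: "c \<in> C \<inter> {c. unique_edge_assembly n c}"
      and d: "d \<in> C \<inter> {c. unique_edge_assembly n c}" and eq: "?m c = ?m d"
    show "c = d"
    proof
      fix e
      show "c e = d e"
      proof (cases "e \<in> board_edges n")
        case True
        then show ?thesis
          using unique_edge_assembly_determined_by_pieces[OF _ eq] d by blast
      next
        \<comment> \<open>Off the board both colorings take the default value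
          \<open>undefined\<close>, so they are equal as functions.\<close>
        case False
        then show ?thesis
          using c d by (simp add: C_def PiE_dflt_def)
      qed
    qed
  qed
  moreover have "?m ` (C \<inter> {c. unique_edge_assembly n c}) \<subseteq> multisets_of_size (pieces q) (n\<^sup>2)"
    by (auto simp: multisets_of_size_def finite_cells card_cells C_def PiE_dflt_def
          intro!: piece_at_in_pieces)
  ultimately have "card (C \<inter> {c. unique_edge_assembly n c})
                     \<le> card (multisets_of_size (pieces q) (n\<^sup>2))"
    using card_inj_on_le finite_multisets_of_size[OF finite_pieces] by blast
  thus ?thesis
    by (simp add: card_multisets_of_size finite_pieces card_pieces)
qed

lemma prob_unique_edge_assembly_le_choose:
  assumes "q > 0"
  shows "measure_pmf.prob (random_coloring n q) {c. unique_edge_assembly n c}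
           \<le> real ((q ^ 4 + n\<^sup>2 - 1) choose n\<^sup>2) / real q ^ (2 * n * (n + 1))"
proof -
  let ?C = "PiE_dflt (board_edges n) undefined (\<lambda>_. {..<q})"
  \<comment> \<open>A product of uniform distributions is uniform on the product set, so the
    probability is a ratio of cardinalities.\<close>
  have C: "random_coloring n q = pmf_of_set ?C"
    unfolding random_coloring_def
    using assms by (intro Pi_pmf_of_set) (auto simp: finite_board_edges)
  have fin: "finite ?C" "?C \<noteq> {}"
    using assms by (auto simp: finite_board_edges)
  have "card ?C = q ^ (2 * n * (n + 1))"
    by (simp add: card_PiE_dflt finite_board_edges card_board_edges)
  thus ?thesis
    using card_unique_edge_assembly_le[of n q]
    by (simp add: C measure_pmf_of_set[OF fin(2,1)] divide_right_mono del: mult_Suc_right)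
qed

text \<open>The left side is a single term of the exponential series, whose terms are all
  nonnegative.\<close>

lemma power_div_fact_le_exp:
  fixes x :: real
  assumes "x \<ge> 0"
  shows "x ^ n / fact n \<le> exp x"
proof -
  have "(\<Sum>k\<in>{n}. x ^ k /\<^sub>R fact k) \<le> (\<Sum>k. x ^ k /\<^sub>R fact k)"
    using assms by (intro sum_le_suminf summable_exp_generic) auto
  thus ?thesis
    by (simp add: exp_def field_simps)
qed

lemma choose_le_exp_power:
  assumes "N > 0"
  shows "real (m choose N) \<le> (exp 1 * real m / real N) ^ N"
proof -
  have "real ((m choose N) * fact N) \<le> real (m ^ N)"
    using binomial_fact_pow of_nat_le_iff by blast
  hence "real (m choose N) * fact N \<le> real m ^ N"
    by simp
  \<comment> \<open>The weak Stirling bound N! \<ge> (N/e)^N, from the exponential series at x =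
    N.\<close>
  moreover have "real N ^ N \<le> exp 1 ^ N * fact N"
    using power_div_fact_le_exp[of "real N" N]
    by (simp add: exp_of_nat_mult[of N 1, simplified] field_simps)
  ultimately have "real (m choose N) * fact N * real N ^ N
                     \<le> real m ^ N * (exp 1 ^ N * fact N)"
    by (intro mult_mono) auto
  hence "real (m choose N) * real N ^ N \<le> real m ^ N * exp 1 ^ N"
    by simp
  thus ?thesis
    using assms by (simp add: power_mult_distrib power_divide field_simps)
qed

lemma prob_unique_edge_assembly_le:
  assumes "n > 0" "q > 0"
  shows "measure_pmf.prob (random_coloring n q) {c. unique_edge_assembly n c}
           \<le> (exp 1 * ((real q)\<^sup>2 / (real n)\<^sup>2 + 1 / (real q)\<^sup>2)) ^ n\<^sup>2 / real q ^ (2 * n)"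
proof -
  \<comment> \<open>Since 2n(n+1) = 2n^2 + 2n, a factor q^2 goes into each of the n^2 factors of the
    binomial bound, and q^(2n) is left over to provide the decay.\<close>
  have split: "real q ^ (2 * n * (n + 1)) = ((real q)\<^sup>2) ^ n\<^sup>2 * real q ^ (2 * n)"
    by (simp add: power_mult[symmetric] power_add[symmetric] power2_eq_square algebra_simps)
  have base: "exp 1 * ((real q)\<^sup>2 / (real n)\<^sup>2 + 1 / (real q)\<^sup>2)
                = exp 1 * real (q ^ 4 + n\<^sup>2) / real (n\<^sup>2) / (real q)\<^sup>2"
    using assms by (simp add: field_simps power_numeral_reduce)
  have "real ((q ^ 4 + n\<^sup>2 - 1) choose n\<^sup>2) \<le> real ((q ^ 4 + n\<^sup>2) choose n\<^sup>2)"
    by (intro of_nat_mono binomial_right_mono) simp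
  also have "\<dots> \<le> (exp 1 * real (q ^ 4 + n\<^sup>2) / real (n\<^sup>2)) ^ n\<^sup>2"
    using assms by (intro choose_le_exp_power) simp
  finally have "real ((q ^ 4 + n\<^sup>2 - 1) choose n\<^sup>2) / real q ^ (2 * n * (n + 1))
      \<le> (exp 1 * real (q ^ 4 + n\<^sup>2) / real (n\<^sup>2)) ^ n\<^sup>2 / real q ^ (2 * n * (n + 1))"
    by (rule divide_right_mono) simp
  also have "\<dots> = (exp 1 * ((real q)\<^sup>2 / (real n)\<^sup>2 + 1 / (real q)\<^sup>2)) ^ n\<^sup>2 / real q ^ (2 * n)"
    unfolding base split by (simp only: power_divide power_mult_distrib divide_divide_eq_left mult.assoc)
  finally show ?thesis
    using prob_unique_edge_assembly_le_choose[OF assms(2), of n] by linarith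
qed

lemma base_le_one:
  fixes n q :: real
  assumes "n \<ge> 10" "q \<ge> 2" "q \<le> 1 / sqrt (exp 1) * n - 1"
  shows "exp 1 * (q\<^sup>2 / n\<^sup>2 + 1 / q\<^sup>2) \<le> 1"
proof (cases "q \<le> n / 3")
  case True
  have "q\<^sup>2 \<le> (n / 3)\<^sup>2"
    using True assms by (intro power_mono) auto
  hence "q\<^sup>2 / n\<^sup>2 \<le> 1 / 9"
    using assms by (simp add: field_simps)
  moreover have "2\<^sup>2 \<le> q\<^sup>2"
    using assms by (intro power_mono) auto
  hence "1 / q\<^sup>2 \<le> 1 / 4"
    by (intro divide_left_mono) auto
  ultimately have "q\<^sup>2 / n\<^sup>2 + 1 / q\<^sup>2 \<le> 1 / 9 + 1 / 4"
    by (rule add_mono)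
  \<comment> \<open>Here 1/9 + 1/4 = 13/36, and 2.72 * 13/36 is about 0.983.\<close>
  hence "exp 1 * (q\<^sup>2 / n\<^sup>2 + 1 / q\<^sup>2) \<le> 272 / 100 * (1 / 9 + 1 / 4)"
    using e_less_272 by (intro mult_mono) simp_all
  also have "\<dots> \<le> 1"
    by simp
  finally show ?thesis .
next
  case False
  define s where "s = sqrt (exp 1)"
  have s: "s\<^sup>2 = exp 1" "s > 0"
    by (simp_all add: s_def)
  have "s\<^sup>2 \<le> 2\<^sup>2"
    using e_less_272 by (simp add: s(1))
  hence s2: "s \<le> 2"
    by (rule power2_le_imp_le) simp
  have "s * (q + 1) \<le> n"
    using assms(3) s(2) by (simp add: s_def[symmetric] field_simps)
  hence "s * q \<le> n - s"
    by (simp add: algebra_simps)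
  hence "(s * q)\<^sup>2 \<le> (n - s)\<^sup>2"
    using s assms by (intro power_mono) auto
  hence "(s * q)\<^sup>2 / n\<^sup>2 \<le> (n - s)\<^sup>2 / n\<^sup>2"
    by (rule divide_right_mono) simp
  \<comment> \<open>In this case q > n/3, so the second summand is at most 9e/n^2, comparable with
    the gain from the gap in the first.\<close>
  moreover have "(n / 3)\<^sup>2 \<le> q\<^sup>2"
    using False assms by (intro power_mono) auto
  hence "s\<^sup>2 / q\<^sup>2 \<le> s\<^sup>2 / (n / 3)\<^sup>2"
    using assms by (intro divide_left_mono) auto
  hence "s\<^sup>2 / q\<^sup>2 \<le> 9 * s\<^sup>2 / n\<^sup>2"
    by (simp add: power_divide mult.commute)
  \<comment> \<open>Expanding reduces this to 10s^2 \<le> 2sn, that is 5s \<le> n; as s \<le> 2, the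
    assumption n \<ge> 10 suffices.\<close>
  moreover have "(n - s)\<^sup>2 + 9 * s\<^sup>2 \<le> n\<^sup>2"
  proof -
    have "5 * s \<le> n"
      using s2 assms by simp
    hence "s * (5 * s) \<le> s * n"
      using s by (intro mult_left_mono) auto
    thus ?thesis
      by (simp add: power2_eq_square algebra_simps)
  qed
  hence "(n - s)\<^sup>2 / n\<^sup>2 + 9 * s\<^sup>2 / n\<^sup>2 \<le> 1"
    using assms by (simp add: add_divide_distrib[symmetric])
  ultimately show ?thesis
    by (simp add: s(1)[symmetric] power_mult_distrib distrib_left)
qed

lemma prob_unique_assembly_le:
  assumes "n \<ge> 10" "q \<ge> 2" "real q \<le> 1 / sqrt (exp 1) * real n - 1"
  shows "measure_pmf.prob (random_coloring n q)
           {c. unique_vertex_assembly n c \<or> unique_edge_assembly n c} \<le> (1 / 4) ^ n"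
proof -
  let ?b = "exp 1 * ((real q)\<^sup>2 / (real n)\<^sup>2 + 1 / (real q)\<^sup>2)"
  have "{c. unique_vertex_assembly n c \<or> unique_edge_assembly n c} = {c. unique_edge_assembly n c}"
    using unique_vertex_imp_unique_edge by auto
  hence "measure_pmf.prob (random_coloring n q)
           {c. unique_vertex_assembly n c \<or> unique_edge_assembly n c}
         \<le> ?b ^ n\<^sup>2 / real q ^ (2 * n)"
    using prob_unique_edge_assembly_le[of n q] assms by simp
  \<comment> \<open>The power of the base is at most 1, and q \<ge> 2 bounds the remaining
    factor.\<close>
  also have "\<dots> \<le> 1 / 2 ^ (2 * n)"
    using assms base_le_one[of "real n" "real q"]
    by (intro frac_le power_le_one power_mono) auto
  also have "\<dots> = (1 / 4) ^ n"
    by (simp add: power_mult power_divide)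
  finally show ?thesis .
qed

theorem mainTheorem2:
  fixes q :: "nat \<Rightarrow> nat"
  assumes "\<And>n. q n \<ge> 2"
    and "filterlim (\<lambda>n. (1 / sqrt (exp 1) * real n - real (q n)) / log 2 (real n))
           at_top sequentially"
  shows "(\<lambda>n. measure_pmf.prob (random_coloring n (q n))
            {c. unique_vertex_assembly n c \<or> unique_edge_assembly n c}) \<longlonglongrightarrow> 0"
proof (rule Lim_null_comparison)
  have "\<forall>\<^sub>F n in sequentially. 1 \<le> (1 / sqrt (exp 1) * real n - real (q n)) / log 2 (real n)"
    using assms(2) by (simp add: filterlim_at_top)
  thus "\<forall>\<^sub>F n in sequentially. norm (measure_pmf.prob (random_coloring n (q n))
          {c. unique_vertex_assembly n c \<or> unique_edge_assembly n c}) \<le> (1 / 4) ^ n"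
    using eventually_ge_at_top[of 10]
  proof eventually_elim
    case (elim n)
    \<comment> \<open>With this, a quotient of at least 1 means that \<open>q n\<close> lies at
      least 1 below n/sqrt(e), the gap that \<open>prob_unique_assembly_le\<close> asks for.\<close>
    have "log 2 (real n) \<ge> 1"
      using elim(2) by (simp add: le_log_iff)
    hence "real (q n) \<le> 1 / sqrt (exp 1) * real n - 1"
      using elim(1) by (simp add: le_divide_eq)
    thus ?case
      using prob_unique_assembly_le[OF elim(2) assms(1)] by simp
  qed
  show "(\<lambda>n. (1 / 4 :: real) ^ n) \<longlonglongrightarrow> 0"
    by (rule LIMSEQ_realpow_zero) auto
qed

end
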